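(* Let $\gamma:\mathbb{R}/\ell\mathbb{Z}\to\mathbb{R}^2$, $\gamma(s)=c+r(\cos(s/r),\sin(s/r))$, be the arclength parametrization of a circle of radius $r>0$ and center $c$ in the plane, where $\ell=2\pi r$. There is no locally arclength preserving (infinitesimal) motion of the circle that increases all antipodal distances to first order; that is, there is no locally arclength preserving variation $V:\mathbb{R}/\ell\mathbb{Z}\to\mathbb{R}^2$ such that $$\bigl(V(s)-V(s+\pi r)\bigr)\cdot\bigl(\gamma(s)-\gamma(s+\pi r)\bigr)>0\quad\text{for all } s.$$
   Context: A locally arclength preserving variation of $\gamma$ is an absolutely continuous map $V:\mathbb{R}/\ell\mathbb{Z}\to\mathbb{R}^2$ (equivalently, an absolutely continuous $V:[0,\ell]\to\mathbb{R}^2$ with $V(0)=V(\ell)$) such that $V'(s)\cdot\gamma'(s)=0$ for almost every $s$. The expression $(V(s)-V(t))\cdot(\gamma(s)-\gamma(t))$ is, up to a positive factor, the first-order rate of change of the distance between $\gamma(s)$ and $\gamma(t)$ under $V$. *)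

theory Defs
  imports "HOL-Analysis.Analysis"
begin

(* The epsilon-delta notion for functions of a real variable. It is unrelated to
   absolutely_continuous of HOL-Analysis.Radon_Nikodym, which relates two measures. *)
definition absolutely_continuous_on_interval ::
    "real \<Rightarrow> real \<Rightarrow> (real \<Rightarrow> 'a::real_normed_vector) \<Rightarrow> bool" where
  "absolutely_continuous_on_interval a b f \<longleftrightarrow>
     (\<forall>\<epsilon>>0. \<exists>\<delta>>0. \<forall>(n::nat) (u :: nat \<Rightarrow> real) (v :: nat \<Rightarrow> real).
        (\<forall>i<n. a \<le> u i \<and> u i \<le> v i \<and> v i \<le> b) \<and>
        disjoint_family_on (\<lambda>i. {u i<..<v i}) {..<n} \<and>
        (\<Sum>i<n. v i - u i) < \<delta>
        \<longrightarrow> (\<Sum>i<n. norm (f (v i) - f (u i))) < \<epsilon>)"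

(* A map on R/LZ is represented by an L-periodic map on R. The derivative of an absolutely
   continuous V exists only almost everywhere, and vector_derivative is unspecified where it
   does not exist; hence the differentiability conjunct, which is part of the meaning of
   "V'(s) . gamma'(s) = 0 for almost every s". *)
definition locally_arclength_preserving_variation ::
    "real \<Rightarrow> (real \<Rightarrow> real^2) \<Rightarrow> (real \<Rightarrow> real^2) \<Rightarrow> bool" where
  "locally_arclength_preserving_variation L \<gamma> V \<longleftrightarrow>
     (\<forall>s. V (s + L) = V s) \<and>
     absolutely_continuous_on_interval 0 L V \<and>
     (AE s\<in>{0..L} in lborel. V differentiable (at s) \<and>
        vector_derivative V (at s) \<bullet> vector_derivative \<gamma> (at s) = 0)"

end

theory Submission
  imports Defs
begin

text \<open>
  Let \<open>e\<close> and \<open>n\<close> be the unit radial and tangent fields of the circle and put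
  \<open>W s = V s - V (s + pi * r)\<close>. As \<open>W\<close>, \<open>e\<close> and \<open>n\<close> all change sign under \<open>s \<mapsto> s + pi * r\<close>,
  the function \<open>q = W \<bullet> n\<close> takes the same value at \<open>0\<close> and at \<open>pi * r\<close>. Preservation of
  arclength kills the term \<open>W' \<bullet> n\<close> of its derivative, so \<open>q' = - (W \<bullet> e) / r\<close> almost
  everywhere. If all antipodal distances increased, \<open>W \<bullet> e\<close> would be positive, and the
  absolutely continuous function \<open>q\<close> would be nonincreasing with equal end values, hence
  constant, against \<open>q' < 0\<close>.
\<close>

section \<open>Absolutely continuous functions\<close>

text \<open>The definition counts intervals by an initial segment of the naturals; enumerating a
  finite set by a bijection frees the index type. This lets a single interval be indexed by
  \<open>unit\<close> and the pieces of a tagged division index themselves.\<close>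

lemma absolutely_continuous_finite_family:
  assumes "absolutely_continuous_on_interval a b f" "\<epsilon> > 0"
  obtains \<delta> where "\<delta> > 0"
    "\<And>(I :: 'i set) l u. finite I \<Longrightarrow> (\<And>i. i \<in> I \<Longrightarrow> a \<le> l i \<and> l i \<le> u i \<and> u i \<le> b) \<Longrightarrow>
       disjoint_family_on (\<lambda>i. {l i<..<u i}) I \<Longrightarrow> (\<Sum>i\<in>I. u i - l i) < \<delta> \<Longrightarrow>
       (\<Sum>i\<in>I. norm (f (u i) - f (l i))) < \<epsilon>"
proof -
  obtain \<delta> where "\<delta> > 0" and \<delta>: "\<And>(n::nat) (l :: nat \<Rightarrow> real) u.
      (\<forall>i<n. a \<le> l i \<and> l i \<le> u i \<and> u i \<le> b) \<and> disjoint_family_on (\<lambda>i. {l i<..<u i}) {..<n} \<and>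
      (\<Sum>i<n. u i - l i) < \<delta> \<Longrightarrow> (\<Sum>i<n. norm (f (u i) - f (l i))) < \<epsilon>"
    using assms unfolding absolutely_continuous_on_interval_def by meson
  show thesis
  proof (rule that[OF \<open>\<delta> > 0\<close>])
    fix I :: "'i set" and l u :: "'i \<Rightarrow> real"
    assume "finite I" and bounds: "\<And>i. i \<in> I \<Longrightarrow> a \<le> l i \<and> l i \<le> u i \<and> u i \<le> b"
      and disj: "disjoint_family_on (\<lambda>i. {l i<..<u i}) I" and len: "(\<Sum>i\<in>I. u i - l i) < \<delta>"
    obtain h where h: "bij_betw h {..<card I} I"
      using ex_bij_betw_nat_finite[OF \<open>finite I\<close>] by (auto simp: atLeast0LessThan)
    have in_I: "h i \<in> I" if "i < card I" for i
      using h that by (auto simp: bij_betw_def)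
    have "disjoint_family_on (\<lambda>i. {l (h i)<..<u (h i)}) {..<card I}"
      unfolding disjoint_family_on_def
    proof (intro ballI impI)
      fix i j assume ij: "i \<in> {..<card I}" "j \<in> {..<card I}" "i \<noteq> j"
      with h have "h i \<noteq> h j"
        unfolding bij_betw_def inj_on_def by blast
      with disj ij show "{l (h i)<..<u (h i)} \<inter> {l (h j)<..<u (h j)} = {}"
        using in_I by (intro disjoint_family_onD[OF disj]) auto
    qed
    moreover have "(\<Sum>i<card I. u (h i) - l (h i)) < \<delta>"
      using len sum.reindex_bij_betw[OF h, of "\<lambda>i. u i - l i"] by simp
    ultimately have "(\<Sum>i<card I. norm (f (u (h i)) - f (l (h i)))) < \<epsilon>"
      using bounds in_I by (intro \<delta>) auto
    then show "(\<Sum>i\<in>I. norm (f (u i) - f (l i))) < \<epsilon>"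
      using sum.reindex_bij_betw[OF h, of "\<lambda>i. norm (f (u i) - f (l i))"] by simp
  qed
qed

section \<open>Restriction, translation and continuity\<close>

lemma absolutely_continuous_subinterval:
  assumes "absolutely_continuous_on_interval a b f" "a \<le> c" "d \<le> b"
  shows "absolutely_continuous_on_interval c d f"
  unfolding absolutely_continuous_on_interval_def
proof (intro allI impI)
  fix \<epsilon> :: real assume "\<epsilon> > 0"
  obtain \<delta> where "\<delta> > 0" and \<delta>: "\<And>(I :: nat set) l u. finite I \<Longrightarrow>
      (\<And>i. i \<in> I \<Longrightarrow> a \<le> l i \<and> l i \<le> u i \<and> u i \<le> b) \<Longrightarrow>
      disjoint_family_on (\<lambda>i. {l i<..<u i}) I \<Longrightarrow> (\<Sum>i\<in>I. u i - l i) < \<delta> \<Longrightarrow>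
      (\<Sum>i\<in>I. norm (f (u i) - f (l i))) < \<epsilon>"
    using absolutely_continuous_finite_family[OF assms(1) \<open>\<epsilon> > 0\<close>] by blast
  show "\<exists>\<delta>>0. \<forall>(n::nat) u v. (\<forall>i<n. c \<le> u i \<and> u i \<le> v i \<and> v i \<le> d) \<and>
      disjoint_family_on (\<lambda>i. {u i<..<v i}) {..<n} \<and> (\<Sum>i<n. v i - u i) < \<delta> \<longrightarrow>
      (\<Sum>i<n. norm (f (v i) - f (u i))) < \<epsilon>"
    using \<open>\<delta> > 0\<close> assms(2,3) by (intro exI[of _ \<delta>] conjI allI impI \<delta>) force+
qed

lemma absolutely_continuous_shift:
  assumes "absolutely_continuous_on_interval (a + c) (b + c) f"
  shows "absolutely_continuous_on_interval a b (\<lambda>x. f (x + c))"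
  unfolding absolutely_continuous_on_interval_def
proof (intro allI impI)
  fix \<epsilon> :: real assume "\<epsilon> > 0"
  obtain \<delta> where "\<delta> > 0" and \<delta>: "\<And>(I :: nat set) l u. finite I \<Longrightarrow>
      (\<And>i. i \<in> I \<Longrightarrow> a + c \<le> l i \<and> l i \<le> u i \<and> u i \<le> b + c) \<Longrightarrow>
      disjoint_family_on (\<lambda>i. {l i<..<u i}) I \<Longrightarrow> (\<Sum>i\<in>I. u i - l i) < \<delta> \<Longrightarrow>
      (\<Sum>i\<in>I. norm (f (u i) - f (l i))) < \<epsilon>"
    using absolutely_continuous_finite_family[OF assms \<open>\<epsilon> > 0\<close>] by blast
  have "(\<Sum>i<n. norm (f (v i + c) - f (u i + c))) < \<epsilon>"
    if "\<forall>i<n. a \<le> u i \<and> u i \<le> v i \<and> v i \<le> b" "(\<Sum>i<n. v i - u i) < \<delta>"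
      and disj: "disjoint_family_on (\<lambda>i. {u i<..<v i}) {..<n}" for n :: nat and u v
  proof (rule \<delta>[of "{..<n}" "\<lambda>i. u i + c" "\<lambda>i. v i + c"])
    have "{u i + c<..<v i + c} = (\<lambda>x. x + c) ` {u i<..<v i}" for i
    proof -
      have "x \<in> (\<lambda>x. x + c) ` {u i<..<v i}" if "x \<in> {u i + c<..<v i + c}" for x
        using that by (intro image_eqI[of _ _ "x - c"]) auto
      then show ?thesis by auto
    qed
    then show "disjoint_family_on (\<lambda>i. {u i + c<..<v i + c}) {..<n}"
      using disj unfolding disjoint_family_on_def by (auto 0 4)
  qed (use that in auto)
  with \<open>\<delta> > 0\<close> show "\<exists>\<delta>>0. \<forall>(n::nat) u v. (\<forall>i<n. a \<le> u i \<and> u i \<le> v i \<and> v i \<le> b) \<and>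
      disjoint_family_on (\<lambda>i. {u i<..<v i}) {..<n} \<and> (\<Sum>i<n. v i - u i) < \<delta> \<longrightarrow>
      (\<Sum>i<n. norm (f (v i + c) - f (u i + c))) < \<epsilon>"
    by blast
qed

lemma absolutely_continuous_imp_continuous_on:
  assumes "absolutely_continuous_on_interval a b f"
  shows "continuous_on {a..b} f"
  unfolding continuous_on_iff
proof (intro ballI allI impI)
  fix x \<epsilon> :: real assume x: "x \<in> {a..b}" and "\<epsilon> > 0"
  obtain \<delta> where "\<delta> > 0" and \<delta>: "\<And>(I :: unit set) l u. finite I \<Longrightarrow>
      (\<And>i. i \<in> I \<Longrightarrow> a \<le> l i \<and> l i \<le> u i \<and> u i \<le> b) \<Longrightarrow>
      disjoint_family_on (\<lambda>i. {l i<..<u i}) I \<Longrightarrow> (\<Sum>i\<in>I. u i - l i) < \<delta> \<Longrightarrow>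
      (\<Sum>i\<in>I. norm (f (u i) - f (l i))) < \<epsilon>"
    using absolutely_continuous_finite_family[OF assms \<open>\<epsilon> > 0\<close>] by blast
  have "dist (f y) (f x) < \<epsilon>" if "y \<in> {a..b}" "dist y x < \<delta>" for y
    \<comment> \<open>A one-member family suffices. Its end points must be ordered, hence
      \<open>min\<close> and \<open>max\<close>.\<close>
    using \<delta>[of "{()}" "\<lambda>_. min x y" "\<lambda>_. max x y"] x that
    by (cases "x \<le> y")
      (auto simp: dist_norm norm_minus_commute disjoint_family_on_def min_def max_def)
  with \<open>\<delta> > 0\<close> show "\<exists>d>0. \<forall>y\<in>{a..b}. dist y x < d \<longrightarrow> dist (f y) (f x) < \<epsilon>"
    by blast
qed

section \<open>Domination, Lipschitz maps, differences and inner products\<close>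

text \<open>Summing the increment bound over a family of intervals shorter in total than both moduli
  gives the claim. The Lipschitz, difference and inner product rules below are all
  instances.\<close>

lemma absolutely_continuous_dominated:
  assumes "absolutely_continuous_on_interval a b f" "absolutely_continuous_on_interval a b g"
    and "B \<ge> 0"
    and dom: "\<And>x y. x \<in> {a..b} \<Longrightarrow> y \<in> {a..b} \<Longrightarrow>
      norm (h y - h x) \<le> B * (norm (f y - f x) + norm (g y - g x))"
  shows "absolutely_continuous_on_interval a b h"
  unfolding absolutely_continuous_on_interval_def
proof (intro allI impI)
  fix \<epsilon> :: real assume "\<epsilon> > 0"
  \<comment> \<open>The 2 pays for the two functions; \<open>B + 1\<close> keeps the quotient
    meaningful and the final estimate strict even if \<open>B = 0\<close>.\<close>
  define \<eta> where "\<eta> = \<epsilon> / (2 * (B + 1))"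
  have "\<eta> > 0"
    using \<open>\<epsilon> > 0\<close> \<open>B \<ge> 0\<close> by (simp add: \<eta>_def)
  obtain \<delta>1 where "\<delta>1 > 0" and \<delta>1: "\<And>(I :: nat set) l u. finite I \<Longrightarrow>
      (\<And>i. i \<in> I \<Longrightarrow> a \<le> l i \<and> l i \<le> u i \<and> u i \<le> b) \<Longrightarrow>
      disjoint_family_on (\<lambda>i. {l i<..<u i}) I \<Longrightarrow> (\<Sum>i\<in>I. u i - l i) < \<delta>1 \<Longrightarrow>
      (\<Sum>i\<in>I. norm (f (u i) - f (l i))) < \<eta>"
    using absolutely_continuous_finite_family[OF assms(1) \<open>\<eta> > 0\<close>] by blast
  obtain \<delta>2 where "\<delta>2 > 0" and \<delta>2: "\<And>(I :: nat set) l u. finite I \<Longrightarrow>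
      (\<And>i. i \<in> I \<Longrightarrow> a \<le> l i \<and> l i \<le> u i \<and> u i \<le> b) \<Longrightarrow>
      disjoint_family_on (\<lambda>i. {l i<..<u i}) I \<Longrightarrow> (\<Sum>i\<in>I. u i - l i) < \<delta>2 \<Longrightarrow>
      (\<Sum>i\<in>I. norm (g (u i) - g (l i))) < \<eta>"
    using absolutely_continuous_finite_family[OF assms(2) \<open>\<eta> > 0\<close>] by blast
  have "(\<Sum>i<n. norm (h (v i) - h (u i))) < \<epsilon>"
    if bounds: "\<forall>i<n. a \<le> u i \<and> u i \<le> v i \<and> v i \<le> b" and len: "(\<Sum>i<n. v i - u i) < min \<delta>1 \<delta>2"
      and disj: "disjoint_family_on (\<lambda>i. {u i<..<v i}) {..<n}" for n :: nat and u v
  proof -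
    have "(\<Sum>i<n. norm (h (v i) - h (u i)))
        \<le> (\<Sum>i<n. B * (norm (f (v i) - f (u i)) + norm (g (v i) - g (u i))))"
      using bounds by (intro sum_mono dom) force+
    also have "\<dots> = B * ((\<Sum>i<n. norm (f (v i) - f (u i))) + (\<Sum>i<n. norm (g (v i) - g (u i))))"
      by (simp add: sum_distrib_left sum.distrib distrib_left)
    also have "\<dots> \<le> B * (\<eta> + \<eta>)"
    proof (intro mult_left_mono[OF _ \<open>B \<ge> 0\<close>] add_mono less_imp_le)
      show "(\<Sum>i<n. norm (f (v i) - f (u i))) < \<eta>"
        using bounds len disj by (intro \<delta>1) auto
      show "(\<Sum>i<n. norm (g (v i) - g (u i))) < \<eta>"
        using bounds len disj by (intro \<delta>2) auto
    qed
    also have "\<dots> < (B + 1) * (\<eta> + \<eta>)"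
      using \<open>\<eta> > 0\<close> by (intro mult_strict_right_mono) auto
    also have "\<dots> = (2 * (B + 1)) * \<eta>"
      by (simp add: algebra_simps)
    also have "\<dots> = \<epsilon>"
      using \<open>B \<ge> 0\<close> by (simp add: \<eta>_def)
    finally show ?thesis .
  qed
  with \<open>\<delta>1 > 0\<close> \<open>\<delta>2 > 0\<close>
  show "\<exists>\<delta>>0. \<forall>(n::nat) u v. (\<forall>i<n. a \<le> u i \<and> u i \<le> v i \<and> v i \<le> b) \<and>
      disjoint_family_on (\<lambda>i. {u i<..<v i}) {..<n} \<and> (\<Sum>i<n. v i - u i) < \<delta> \<longrightarrow>
      (\<Sum>i<n. norm (h (v i) - h (u i))) < \<epsilon>"
    by (intro exI[of _ "min \<delta>1 \<delta>2"]) auto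
qed

lemma absolutely_continuous_ident:
  "absolutely_continuous_on_interval a b (\<lambda>x. x)"
  unfolding absolutely_continuous_on_interval_def by (intro allI impI) (auto simp: abs_of_nonneg)

text \<open>The increments are dominated by those of the identity, which here takes the place of
  both dominating functions.\<close>

lemma lipschitz_imp_absolutely_continuous:
  assumes "C-lipschitz_on {a..b} f"
  shows "absolutely_continuous_on_interval a b f"
proof (rule absolutely_continuous_dominated[OF absolutely_continuous_ident
      absolutely_continuous_ident lipschitz_on_nonneg[OF assms]])
  fix x y assume "x \<in> {a..b}" "y \<in> {a..b}"
  then have "norm (f y - f x) \<le> C * norm (y - x)"
    using lipschitz_onD[OF assms] by (simp add: dist_norm)
  also have "\<dots> \<le> C * (norm (y - x) + norm (y - x))"
    using lipschitz_on_nonneg[OF assms] by (intro mult_left_mono) auto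
  finally show "norm (f y - f x) \<le> C * (norm (y - x) + norm (y - x))" .
qed

lemma absolutely_continuous_diff:
  assumes "absolutely_continuous_on_interval a b f" "absolutely_continuous_on_interval a b g"
  shows "absolutely_continuous_on_interval a b (\<lambda>x. f x - g x)"
proof (rule absolutely_continuous_dominated[OF assms, of 1])
  fix x y
  have "f y - g y - (f x - g x) = (f y - f x) - (g y - g x)"
    by simp
  then show "norm (f y - g y - (f x - g x)) \<le> 1 * (norm (f y - f x) + norm (g y - g x))"
    by (metis mult_1 norm_triangle_ineq4)
qed simp

text \<open>Both factors are continuous on a compact interval, hence bounded, and the usual
  splitting of a product increment gives domination with the larger bound as factor.\<close>

lemma absolutely_continuous_inner:
  fixes f g :: "real \<Rightarrow> 'a::real_inner"
  assumes f: "absolutely_continuous_on_interval a b f"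
    and g: "absolutely_continuous_on_interval a b g"
  shows "absolutely_continuous_on_interval a b (\<lambda>x. f x \<bullet> g x)"
proof -
  have "bounded (f ` {a..b})" "bounded (g ` {a..b})"
    using absolutely_continuous_imp_continuous_on[OF f] absolutely_continuous_imp_continuous_on[OF g]
    by (auto intro: compact_imp_bounded compact_continuous_image)
  then obtain K M where K: "\<And>x. x \<in> {a..b} \<Longrightarrow> norm (f x) \<le> K"
    and M: "\<And>x. x \<in> {a..b} \<Longrightarrow> norm (g x) \<le> M"
    unfolding bounded_iff by blast
  define B where "B = max 0 (max K M)"
  show ?thesis
  proof (rule absolutely_continuous_dominated[OF f g, of B])
    fix x y assume xy: "x \<in> {a..b}" "y \<in> {a..b}"
    have "f y \<bullet> g y - f x \<bullet> g x = (f y - f x) \<bullet> g y + f x \<bullet> (g y - g x)"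
      by (simp add: inner_diff_left inner_diff_right)
    then have "norm (f y \<bullet> g y - f x \<bullet> g x)
        \<le> norm (f y - f x) * norm (g y) + norm (f x) * norm (g y - g x)"
      by (smt (verit) Cauchy_Schwarz_ineq2 real_norm_def)
    also have "\<dots> \<le> norm (f y - f x) * B + B * norm (g y - g x)"
      using K[OF xy(1)] M[OF xy(2)]
      by (intro add_mono mult_left_mono mult_right_mono) (auto simp: B_def)
    finally show "norm (f y \<bullet> g y - f x \<bullet> g x) \<le> B * (norm (f y - f x) + norm (g y - g x))"
      by (simp add: algebra_simps)
  qed (simp add: B_def)
qed

section \<open>Monotonicity from the sign of the derivative almost everywhere\<close>

text \<open>
  Over a tagged division fine for a suitable gauge, the increments at tags outside \<open>N\<close> are
  controlled by the derivative, and the intervals with tags in \<open>N\<close> lie in an open set of small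
  measure, so that absolute continuity bounds their increments.
\<close>
lemma absolutely_continuous_nonincreasing:
  fixes f :: "real \<Rightarrow> real"
  assumes "a \<le> b" and ac: "absolutely_continuous_on_interval a b f" and "negligible N"
    and deriv: "\<And>x. x \<in> {a..b} - N \<Longrightarrow> \<exists>D\<le>0. (f has_real_derivative D) (at x)"
  shows "f b \<le> f a"
proof -
  have main: "f b - f a \<le> \<epsilon> * (b - a) + \<epsilon>" if "\<epsilon> > 0" for \<epsilon>
  proof -
    obtain \<delta> where "\<delta> > 0" and \<delta>: "\<And>(I :: (real \<times> real set) set) l u. finite I \<Longrightarrow>
        (\<And>i. i \<in> I \<Longrightarrow> a \<le> l i \<and> l i \<le> u i \<and> u i \<le> b) \<Longrightarrow>
        disjoint_family_on (\<lambda>i. {l i<..<u i}) I \<Longrightarrow> (\<Sum>i\<in>I. u i - l i) < \<delta> \<Longrightarrow>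
        (\<Sum>i\<in>I. norm (f (u i) - f (l i))) < \<epsilon>"
      using absolutely_continuous_finite_family[OF ac \<open>\<epsilon> > 0\<close>] by blast
    have N: "N \<in> sets lebesgue" "emeasure lebesgue N = 0"
      using \<open>negligible N\<close> by (auto simp: negligible_iff_null_sets)
    obtain U where U: "open U" "N \<subseteq> U" "emeasure lebesgue (U - N) < ennreal \<delta>"
      using sets_lebesgue_outer_open[OF N(1) \<open>\<delta> > 0\<close>] by blast
    have "emeasure lebesgue U = emeasure lebesgue (U - N)"
      using N U(1) by (intro emeasure_Diff_null_set[symmetric]) auto
    with U have emU: "emeasure lborel U < ennreal \<delta>"
      by simp
    have "\<exists>d>0. x \<in> {a..b} - N \<longrightarrow>
        (\<forall>u v. u \<le> x \<and> x \<le> v \<and> u \<in> ball x d \<and> v \<in> ball x d \<longrightarrow> f v - f u \<le> \<epsilon> * (v - u))" for x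
    proof (cases "x \<in> {a..b} - N")
      case True
      then obtain D where "D \<le> 0" "(f has_real_derivative D) (at x)"
        using deriv by blast
      then obtain d where "d > 0" and d: "\<And>y. norm (y - x) < d \<Longrightarrow>
          norm (f y - f x - D * (y - x)) \<le> \<epsilon> * norm (y - x)"
        using \<open>\<epsilon> > 0\<close> unfolding has_field_derivative_def has_derivative_at_alt by blast
      have "f v - f u \<le> \<epsilon> * (v - u)"
        if "u \<le> x" "x \<le> v" "u \<in> ball x d" "v \<in> ball x d" for u v
      proof -
        have "f v - f x - D * (v - x) \<le> \<epsilon> * (v - x)"
          using d[of v] that by (auto simp: dist_real_def)
        moreover have "f x - f u - D * (x - u) \<le> \<epsilon> * (x - u)"
          using d[of u] that by (auto simp: dist_real_def algebra_simps)
        moreover have "D * (v - x) \<le> 0" "D * (x - u) \<le> 0"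
          using \<open>D \<le> 0\<close> that by (auto intro: mult_nonpos_nonneg)
        ultimately show ?thesis
          by (simp add: algebra_simps)
      qed
      with \<open>d > 0\<close> show ?thesis by blast
    qed (auto intro: exI[of _ 1])
    then obtain d where d: "\<And>x. d x > 0"
      and small: "\<And>x u v. x \<in> {a..b} - N \<Longrightarrow> u \<le> x \<Longrightarrow> x \<le> v \<Longrightarrow> u \<in> ball x (d x) \<Longrightarrow>
        v \<in> ball x (d x) \<Longrightarrow> f v - f u \<le> \<epsilon> * (v - u)"
      by metis
    \<comment> \<open>At tags in \<open>N\<close> the gauge is the whole of \<open>U\<close>, which
      forces every interval with such a tag into \<open>U\<close>.\<close>
    define g where "g x = (if x \<in> N then U else ball x (d x))" for x
    have "gauge g"
      using U d by (auto simp: gauge_def g_def)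
    then obtain p where p: "p tagged_division_of {a..b}" and "g fine p"
      by (rule fine_division_exists_real)
    have "finite p"
      using p by auto
    \<comment> \<open>A piece of the division contains its tag, so it is a nonempty closed interval
      and \<open>Inf\<close> and \<open>Sup\<close> recover its end points.\<close>
    have tag: "K = {Inf K..Sup K} \<and> Inf K \<le> x \<and> x \<le> Sup K \<and> a \<le> Inf K \<and> Sup K \<le> b \<and> K \<subseteq> g x"
      if xK: "(x, K) \<in> p" for x K
    proof -
      obtain l u where "K = {l..u}"
        using tagged_division_ofD(4)[OF p xK] by auto
      moreover have "x \<in> K" "K \<subseteq> {a..b}" "K \<subseteq> g x"
        using tagged_division_ofD(2,3)[OF p xK] \<open>g fine p\<close> xK by (auto simp: fine_def)
      ultimately show ?thesis by auto
    qed
    define P where "P = {(x, K) \<in> p. x \<in> N}"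
    have "finite P" "P \<subseteq> p"
      using \<open>finite p\<close> by (auto simp: P_def intro: finite_subset)
    have disj: "disjoint_family_on (\<lambda>i. {Inf (snd i)<..<Sup (snd i)}) P"
      unfolding disjoint_family_on_def
    proof (intro ballI impI)
      fix i j assume ij: "i \<in> P" "j \<in> P" "i \<noteq> j"
      have int: "interior (snd i) = {Inf (snd i)<..<Sup (snd i)}" if "i \<in> P" for i
      proof -
        have "snd i = {Inf (snd i)..Sup (snd i)}"
          using that tag[of "fst i" "snd i"] \<open>P \<subseteq> p\<close> by auto
        then show ?thesis
          by (metis interior_atLeastAtMost_real)
      qed
      have "interior (snd i) \<inter> interior (snd j) = {}"
        using tagged_division_ofD(5)[OF p, of "fst i" "snd i" "fst j" "snd j"] ij \<open>P \<subseteq> p\<close>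
        by (auto simp: prod_eq_iff)
      with int ij show "{Inf (snd i)<..<Sup (snd i)} \<inter> {Inf (snd j)<..<Sup (snd j)} = {}"
        by simp
    qed
    have len: "(\<Sum>i\<in>P. Sup (snd i) - Inf (snd i)) < \<delta>"
    proof -
      \<comment> \<open>Passing to the open intervals makes the family disjoint without changing
        lengths, so the total length is the measure of a union inside \<open>U\<close>.\<close>
      have "ennreal (\<Sum>i\<in>P. Sup (snd i) - Inf (snd i))
          = (\<Sum>i\<in>P. emeasure lborel {Inf (snd i)<..<Sup (snd i)})"
        using tag \<open>P \<subseteq> p\<close> by (subst sum_ennreal[symmetric]) (force intro!: sum.cong)+
      also have "\<dots> = emeasure lborel (\<Union>i\<in>P. {Inf (snd i)<..<Sup (snd i)})"
        using disj \<open>finite P\<close> by (intro sum_emeasure) auto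
      also have "\<dots> \<le> emeasure lborel U"
      proof (rule emeasure_mono)
        show "(\<Union>i\<in>P. {Inf (snd i)<..<Sup (snd i)}) \<subseteq> U"
        proof (rule UN_least)
          fix i assume "i \<in> P"
          then have "snd i = {Inf (snd i)..Sup (snd i)}" "snd i \<subseteq> U"
            using tag[of "fst i" "snd i"] by (auto simp: P_def g_def)
          then show "{Inf (snd i)<..<Sup (snd i)} \<subseteq> U"
            by (metis greaterThanLessThan_subseteq_atLeastAtMost_iff order_refl subset_trans)
        qed
      qed (use U in auto)
      also note emU
      finally show ?thesis
        by (meson ennreal_leI leD not_le_imp_less)
    qed
    have "(\<Sum>i\<in>P. norm (f (Sup (snd i)) - f (Inf (snd i)))) < \<epsilon>"
      using \<open>finite P\<close> disj len tag \<open>P \<subseteq> p\<close> by (intro \<delta>) force+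
    moreover have "(\<Sum>i\<in>P. f (Sup (snd i)) - f (Inf (snd i)))
        \<le> (\<Sum>i\<in>P. norm (f (Sup (snd i)) - f (Inf (snd i))))"
      by (intro sum_mono) auto
    moreover have "(\<Sum>i\<in>p - P. f (Sup (snd i)) - f (Inf (snd i))) \<le> \<epsilon> * (b - a)"
    proof -
      have "(\<Sum>i\<in>p - P. f (Sup (snd i)) - f (Inf (snd i)))
          \<le> (\<Sum>i\<in>p - P. \<epsilon> * (Sup (snd i) - Inf (snd i)))"
      proof (rule sum_mono)
        fix i assume i: "i \<in> p - P"
        obtain x K where [simp]: "i = (x, K)" by force
        have K: "K = {Inf K..Sup K}" "Inf K \<le> x" "x \<le> Sup K" "a \<le> Inf K" "Sup K \<le> b"
          and "x \<notin> N" "K \<subseteq> ball x (d x)"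
          using i tag[of x K] by (auto simp: P_def g_def)
        moreover have "Inf K \<in> K" "Sup K \<in> K"
          using K by (metis atLeastAtMost_iff order_refl order_trans)+
        ultimately show "f (Sup (snd i)) - f (Inf (snd i)) \<le> \<epsilon> * (Sup (snd i) - Inf (snd i))"
          by (auto intro!: small[of x])
      qed
      \<comment> \<open>Putting back the pieces with tags in \<open>N\<close> adds only nonnegative
        terms, and the full sum of lengths telescopes to \<open>b - a\<close>.\<close>
      also have "\<dots> \<le> (\<Sum>i\<in>p. \<epsilon> * (Sup (snd i) - Inf (snd i)))"
        using \<open>finite p\<close> \<open>\<epsilon> > 0\<close> tag by (intro sum_mono2) force+
      also have "\<dots> = \<epsilon> * (b - a)"
        using additive_tagged_division_1[OF \<open>a \<le> b\<close> p, of "\<lambda>x. x"]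
        by (simp add: sum_distrib_left[symmetric] case_prod_unfold)
      finally show ?thesis .
    qed
    moreover have "f b - f a = (\<Sum>i\<in>p. f (Sup (snd i)) - f (Inf (snd i)))"
      using additive_tagged_division_1[OF \<open>a \<le> b\<close> p, of f] by (simp add: case_prod_unfold)
    moreover have "\<dots> = (\<Sum>i\<in>p - P. f (Sup (snd i)) - f (Inf (snd i)))
        + (\<Sum>i\<in>P. f (Sup (snd i)) - f (Inf (snd i)))"
      using \<open>finite p\<close> \<open>P \<subseteq> p\<close> by (rule sum.subset_diff[rotated])
    ultimately show ?thesis by linarith
  qed
  have "f b - f a \<le> 0 + \<epsilon>" if "\<epsilon> > 0" for \<epsilon>
  proof -
    \<comment> \<open>The rescaling divides by \<open>b - a + 1\<close>, which is positive even if
      \<open>a = b\<close>.\<close>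
    have "f b - f a \<le> (\<epsilon> / (b - a + 1)) * (b - a + 1)"
      using main[of "\<epsilon> / (b - a + 1)"] that \<open>a \<le> b\<close> by (simp add: distrib_left)
    then show ?thesis
      using \<open>a \<le> b\<close> by simp
  qed
  then have "f b - f a \<le> 0"
    by (rule field_le_epsilon)
  then show ?thesis by simp
qed

section \<open>The circle\<close>

text \<open>Turns \<open>vector\<close> into sums and scalar multiples, to which the derivative
  rules apply.\<close>

lemma vector_2_eq_scaleR_axis:
  "(vector [x, y] :: real^2) = x *\<^sub>R axis 1 1 + y *\<^sub>R axis 2 1"
  by (simp add: vec_eq_iff forall_2 axis_def)

lemma has_vector_derivative_vector_2:
  assumes "(f has_real_derivative f') (at s)" "(g has_real_derivative g') (at s)"
  shows "((\<lambda>s. vector [f s, g s] :: real^2) has_vector_derivative vector [f', g']) (at s)"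
  unfolding vector_2_eq_scaleR_axis using assms by (auto intro!: derivative_eq_intros)

theorem proposition3p7p18:
  fixes c :: "real^2" and r L :: real and \<gamma> :: "real \<Rightarrow> real^2"
  assumes "r > 0"
    and "L = 2 * pi * r"
    and "\<gamma> = (\<lambda>s. c + r *\<^sub>R vector [cos (s / r), sin (s / r)])"
  shows "\<not> (\<exists>V :: real \<Rightarrow> real^2. locally_arclength_preserving_variation L \<gamma> V \<and>
            (\<forall>s. (V s - V (s + pi * r)) \<bullet> (\<gamma> s - \<gamma> (s + pi * r)) > 0))"
proof (rule notI, elim exE conjE)
  fix V :: "real \<Rightarrow> real^2"
  assume V: "locally_arclength_preserving_variation L \<gamma> V"
    and pos: "\<forall>s. (V s - V (s + pi * r)) \<bullet> (\<gamma> s - \<gamma> (s + pi * r)) > 0"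
  have period: "\<And>s. V (s + L) = V s"
    and acV: "absolutely_continuous_on_interval 0 L V"
    and aeV: "AE s\<in>{0..L} in lborel. V differentiable (at s) \<and>
      vector_derivative V (at s) \<bullet> vector_derivative \<gamma> (at s) = 0"
    using V by (auto simp: locally_arclength_preserving_variation_def)

  \<comment> \<open>The half period and the moving frame\<close>
  define h where "h = pi * r"
  have "h > 0" and L: "L = h + h"
    using assms by (auto simp: h_def)
  define e :: "real \<Rightarrow> real^2" where "e s = vector [cos (s / r), sin (s / r)]" for s
  define n :: "real \<Rightarrow> real^2" where "n s = vector [- sin (s / r), cos (s / r)]" for s
  have half: "(s + h) / r = s / r + pi" for s
    using \<open>r > 0\<close> by (simp add: h_def field_simps)
  have e_h: "e (s + h) = - e s" and n_h: "n (s + h) = - n s" for s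
    by (simp_all add: e_def n_def half vec_eq_iff forall_2)
  have e_deriv: "(e has_vector_derivative (1 / r) *\<^sub>R n s) (at s)" for s
  proof -
    have "(1 / r) *\<^sub>R n s = vector [- sin (s / r) * (1 / r), cos (s / r) * (1 / r)]"
      by (simp add: n_def vec_eq_iff forall_2)
    then show ?thesis
      unfolding e_def using \<open>r > 0\<close>
      by (auto intro!: has_vector_derivative_vector_2 derivative_eq_intros)
  qed
  have n_deriv: "(n has_vector_derivative - (1 / r) *\<^sub>R e s) (at s)" for s
  proof -
    have "- (1 / r) *\<^sub>R e s = vector [- (cos (s / r) * (1 / r)), - sin (s / r) * (1 / r)]"
      by (simp add: e_def vec_eq_iff forall_2)
    then show ?thesis
      unfolding n_def using \<open>r > 0\<close>
      by (auto intro!: has_vector_derivative_vector_2 derivative_eq_intros)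
  qed
  have \<gamma>_deriv: "vector_derivative \<gamma> (at s) = n s" for s
  proof (rule vector_derivative_at)
    have "\<gamma> = (\<lambda>s. c + r *\<^sub>R e s)"
      by (simp add: assms(3) e_def)
    then show "(\<gamma> has_vector_derivative n s) (at s)"
      using \<open>r > 0\<close> by (auto intro!: derivative_eq_intros e_deriv)
  qed

  \<comment> \<open>Radial and tangential components of \<open>W\<close>\<close>
  define W where "W s = V s - V (s + h)" for s
  define q where "q s = W s \<bullet> n s" for s
  \<comment> \<open>Antipodal points differ by the diameter \<open>2 * r\<close> along
    \<open>e s\<close>, so the assumed inequality is this one up to a positive factor.\<close>
  have We: "W s \<bullet> e s > 0" for s
  proof -
    have "\<gamma> s - \<gamma> (s + h) = (2 * r) *\<^sub>R e s"
      using e_h[of s] by (simp add: assms(3) e_def scaleR_right_diff_distrib[symmetric]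
          vec_eq_iff forall_2)
    with pos[rule_format, of s] \<open>r > 0\<close> show ?thesis
      by (simp add: W_def h_def zero_less_mult_iff)
  qed
  \<comment> \<open>Periodicity gives \<open>W h = - W 0\<close>, and this sign cancels against
    \<open>n h = - n 0\<close>.\<close>
  have q_h: "q h = q 0"
    using period[of 0] n_h[of 0] by (simp add: q_def W_def L algebra_simps)

  \<comment> \<open>Absolute continuity of \<open>q\<close> on a half period\<close>
  have acq: "absolutely_continuous_on_interval 0 h q"
    unfolding q_def W_def
  proof (intro absolutely_continuous_inner absolutely_continuous_diff)
    \<comment> \<open>On \<open>{0..h}\<close> both \<open>s\<close> and \<open>s + h\<close> stay
      in \<open>{0..L}\<close>, where absolute continuity of \<open>V\<close> is given.\<close>
    show "absolutely_continuous_on_interval 0 h V"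
      using \<open>h > 0\<close> by (intro absolutely_continuous_subinterval[OF acV]) (auto simp: L)
    show "absolutely_continuous_on_interval 0 h (\<lambda>s. V (s + h))"
      using \<open>h > 0\<close>
      by (intro absolutely_continuous_shift absolutely_continuous_subinterval[OF acV]) (auto simp: L)
    \<comment> \<open>The Lipschitz constant of \<open>n\<close> is a bound for its derivative,
      obtained by compactness.\<close>
    have "continuous_on {0..h} e"
      using e_deriv by (meson continuous_at_imp_continuous_on has_vector_derivative_continuous)
    then have "bounded ((\<lambda>s. - (1 / r) *\<^sub>R e s) ` {0..h})"
      by (intro compact_imp_bounded compact_continuous_image continuous_intros) auto
    then obtain C where C: "\<And>s. s \<in> {0..h} \<Longrightarrow> norm (- (1 / r) *\<^sub>R e s) \<le> C"
      unfolding bounded_iff by blast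
    then have "C \<ge> 0"
      using \<open>h > 0\<close> by (meson atLeastAtMost_iff less_imp_le norm_ge_zero order_refl order_trans)
    have "C-lipschitz_on {0..h} n"
    proof (rule bounded_derivative_imp_lipschitz[OF _ _ _ \<open>C \<ge> 0\<close>])
      show "(n has_derivative (\<lambda>x. x *\<^sub>R (- (1 / r) *\<^sub>R e s))) (at s within {0..h})" for s
        using n_deriv[of s] has_derivative_at_withinI
        unfolding has_vector_derivative_def by blast
      show "onorm (\<lambda>x. x *\<^sub>R (- (1 / r) *\<^sub>R e s)) \<le> C" if "s \<in> {0..h}" for s
        using mult_left_mono[OF C[OF that] abs_ge_zero] \<open>C \<ge> 0\<close>
        by (intro onorm_bound) (simp_all only: norm_scaleR mult.commute[of C] real_norm_def)
    qed auto
    then show "absolutely_continuous_on_interval 0 h n"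
      by (rule lipschitz_imp_absolutely_continuous)
  qed

  \<comment> \<open>The derivative of \<open>q\<close> off a null set\<close>
  obtain Z where Z: "negligible Z" and good: "\<And>s. s \<in> {0..L} - Z \<Longrightarrow>
      V differentiable (at s) \<and> vector_derivative V (at s) \<bullet> n s = 0"
  proof -
    obtain Z where "{s \<in> space lborel. \<not> (s \<in> {0..L} \<longrightarrow> V differentiable (at s) \<and>
        vector_derivative V (at s) \<bullet> vector_derivative \<gamma> (at s) = 0)} \<subseteq> Z"
      and "emeasure lborel Z = 0" "Z \<in> sets lborel"
      using aeV by (rule AE_E)
    moreover from this have "negligible Z"
      unfolding negligible_iff_null_sets by (intro null_sets_completionI) auto
    ultimately show thesis
      using \<gamma>_deriv by (intro that[of Z]) auto
  qed
  \<comment> \<open>Avoiding \<open>Z\<close> and its translate by \<open>- h\<close> makes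
    \<open>V\<close> well behaved at \<open>s\<close> and at \<open>s + h\<close>
    simultaneously.\<close>
  define N where "N = Z \<union> (\<lambda>s. - h + s) ` Z"
  have "negligible N"
    using Z negligible_translation[OF Z, of "- h"] by (auto simp: N_def)
  have q_deriv: "(q has_real_derivative - (W s \<bullet> e s) / r) (at s)" if s: "s \<in> {0..h} - N" for s
  proof -
    have "s \<in> {0..L} - Z" "s + h \<in> {0..L} - Z"
      using s \<open>h > 0\<close> by (auto simp: N_def L image_iff)
    note goods = this[THEN good]
    define D1 D2 where "D1 = vector_derivative V (at s)"
      and "D2 = vector_derivative V (at (s + h))"
    \<comment> \<open>At \<open>s + h\<close> the variation is orthogonal to
      \<open>n (s + h) = - n s\<close>, so both derivatives are orthogonal to the same vector
      \<open>n s\<close> and \<open>(D1 - D2) \<bullet> n s\<close> vanishes below.\<close>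
    with goods have D1: "(V has_vector_derivative D1) (at s)" "D1 \<bullet> n s = 0"
      and D2: "(V has_vector_derivative D2) (at (s + h))" "D2 \<bullet> n s = 0"
      by (auto simp: vector_derivative_works n_h)
    have "((\<lambda>s. s + h) has_vector_derivative 1) (at s)"
      by (auto intro!: derivative_eq_intros)
    from vector_diff_chain_at[OF this D2(1)]
    have "((\<lambda>s. V (s + h)) has_vector_derivative D2) (at s)"
      by (simp add: o_def)
    then have "(W has_vector_derivative D1 - D2) (at s)"
      unfolding W_def by (intro has_vector_derivative_diff D1)
    from bounded_bilinear.has_vector_derivative[OF bounded_bilinear_inner this n_deriv]
    have "(q has_vector_derivative W s \<bullet> (- (1 / r) *\<^sub>R e s) + (D1 - D2) \<bullet> n s) (at s)"
      unfolding q_def .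
    then show ?thesis
      using D1(2) D2(2)
      by (simp add: has_real_derivative_iff_has_vector_derivative inner_diff_left)
  qed

  \<comment> \<open>Constancy of \<open>q\<close> and the contradiction\<close>
  have q_mono: "q v \<le> q u" if "0 \<le> u" "u \<le> v" "v \<le> h" for u v
  proof (rule absolutely_continuous_nonincreasing[OF \<open>u \<le> v\<close> _ \<open>negligible N\<close>])
    show "absolutely_continuous_on_interval u v q"
      using acq that by (auto intro: absolutely_continuous_subinterval)
    show "\<exists>D\<le>0. (q has_real_derivative D) (at s)" if s: "s \<in> {u..v} - N" for s
    proof (intro exI conjI)
      show "- (W s \<bullet> e s) / r \<le> 0"
        using We[of s] \<open>r > 0\<close> by (intro divide_nonpos_pos) auto
      show "(q has_real_derivative - (W s \<bullet> e s) / r) (at s)"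
        using s \<open>0 \<le> u\<close> \<open>v \<le> h\<close> by (intro q_deriv) auto
    qed
  qed
  \<comment> \<open>Monotonicity squeezes \<open>q s\<close> between \<open>q h\<close> and
    \<open>q 0\<close>, which agree.\<close>
  have q_const: "q s = q 0" if "s \<in> {0..h}" for s
    using q_mono[of 0 s] q_mono[of s h] q_h that by simp
  \<comment> \<open>An interior point off \<open>N\<close> is wanted: there the two-sided derivative
    is 0 by constancy and negative by \<open>q_deriv\<close>.\<close>
  have "\<not> negligible {0<..<h}"
    using \<open>h > 0\<close> by (intro open_not_negligible) auto
  then have "\<not> {0<..<h} \<subseteq> N"
    using \<open>negligible N\<close> negligible_subset by blast
  then obtain s where s: "s \<in> {0<..<h}" "s \<notin> N"
    by blast
  have "(q has_real_derivative 0) (at s)"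
  proof (rule has_field_derivative_transform_within_open[OF DERIV_const])
    show "open {0<..<h}" "s \<in> {0<..<h}"
      using s by auto
    show "q 0 = q x" if "x \<in> {0<..<h}" for x
      using q_const[of x] that by simp
  qed
  moreover have "(q has_real_derivative - (W s \<bullet> e s) / r) (at s)"
    using s by (intro q_deriv) auto
  ultimately have "0 = - (W s \<bullet> e s) / r"
    by (rule DERIV_unique)
  with We[of s] \<open>r > 0\<close> show False
    by simp
qed

end
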